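(* Let $N$ be a unital, zero-symmetric (right) loop near-ring such that $J_2(N)\neq N$, i.e. $N$ has at least one $N$-maximal left ideal. Then the following properties are equivalent: (a) $N$ is local, i.e. $N$ has a unique maximal left $N$-subloop $\mathfrak{m}\subsetneq N$. (b) $N$ has a unique $N$-maximal left ideal $K$, and this $K$ is quasiregular. (c) $J_2(N)$ is quasiregular and $N/J_2(N)$ is a loop near-field. (d) $N\setminus U(N)$ is an ideal in $N$. (e) $N\setminus U(N)$ is a subloop in $(N,+)$. (f) For all $m,n\in N$, $m+n\in U(N)$ implies $m\in U(N)$ or $n\in U(N)$. Moreover, if any one (equivalently, all) of the properties (a)–(f) holds, then the equalities $\mathfrak{m}=R(N)=J_2(N)=N\setminus U(N)$ hold, where $\mathfrak{m}$ is the unique maximal left $N$-subloop of $N$.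
   Context: Loops. A loop is a set $G$ with a binary operation $+$ and an element $0$ such that $0+a=a+0=a$ for all $a\in G$, and for all $a,b\in G$ the equations $a+x=b$ and $y+a=b$ have unique solutions $x,y\in G$. A subloop is a nonempty subset closed under $+$ and under forming the solutions $x,y$ of these equations. A subloop $K$ of $G$ is normal if $a+K=K+a$, $(a+b)+K=a+(b+K)$ and $(K+a)+b=K+(a+b)$ for all $a,b\in G$. Loop near-rings. A (right) loop near-ring is a set $N$ with operations $+,\cdot$ such that $(N,+)$ is a loop, $(N,\cdot)$ is a semigroup, and $(m_1+m_2)n=m_1n+m_2n$ for all $m_1,m_2,n\in N$. It is unital if it has a two-sided multiplicative identity $1$, and zero-symmetric if $n0=0$ for all $n\in N$. An element $u\in N$ is a unit if $uv=vu=1$ for some $v\in N$; $U(N)$ denotes the group of units. $N$ is a loop near-field if $U(N)=N\setminus\{0\}$. Substructures. A left $N$-subloop of $N$ is a subloop $I$ of $(N,+)$ with $NI\subseteq I$; it is maximal if it is maximal among the left $N$-subloops different from $N$. A left ideal of $N$ is a normal subloop $K$ of $(N,+)$ such that $n(a+k)+K=na+K$ for all $n,a\in N$, $k\in K$ (equivalently, the kernel of a homomorphism of left $N$-modules out of $N$). An ideal is a left ideal $K$ with $KN\subseteq K$; then $N/K$ is a loop near-ring under $(n+K)+(m+K)=(n+m)+K$, $(n+K)(m+K)=nm+K$. A left ideal is $N$-maximal if it is a maximal left $N$-subloop. $J_2(N)$ is the intersection of all $N$-maximal left ideals of $N$ (with $J_2(N)=N$ if there are none); it is a two-sided ideal of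 $N$. $R(N)$ is the intersection of all maximal left $N$-subloops of $N$. An element $q\in N$ is quasiregular if the unique solution $y$ of $y+q=1$ has a left inverse, i.e. there is $y^\lambda\in N$ with $y^\lambda y=1$. A subset of $N$ is quasiregular if all its elements are. *)

theory Defs
  imports "HOL-Algebra.AbelCoset"
begin

text \<open>
  Loop near-rings are carried by the ring records of HOL-Algebra.  The record type imposes no
  axioms, and \<^term>\<open>Units\<close>, \<^term>\<open>a_l_coset\<close> and \<^term>\<open>a_r_coset\<close> (the cosets
  \<open>a <+\<^bsub>N\<^esub> K\<close> and \<open>K +>\<^bsub>N\<^esub> a\<close>) only refer to the operations of the record, so they
  are available without associativity or commutativity of addition.
\<close>

locale additive_loop =
  fixes N :: "('a, 'b) ring_scheme" (structure)
  assumes add_closed: "\<lbrakk>a \<in> carrier N; b \<in> carrier N\<rbrakk> \<Longrightarrow> a \<oplus> b \<in> carrier N"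
    and zero_closed: "\<zero> \<in> carrier N"
    and zero_add: "a \<in> carrier N \<Longrightarrow> \<zero> \<oplus> a = a"
    and add_zero: "a \<in> carrier N \<Longrightarrow> a \<oplus> \<zero> = a"
    and right_solution: "\<lbrakk>a \<in> carrier N; b \<in> carrier N\<rbrakk> \<Longrightarrow> \<exists>!x. x \<in> carrier N \<and> a \<oplus> x = b"
    and left_solution: "\<lbrakk>a \<in> carrier N; b \<in> carrier N\<rbrakk> \<Longrightarrow> \<exists>!y. y \<in> carrier N \<and> y \<oplus> a = b"

locale loop_near_ring = additive_loop +
  assumes mult_closed: "\<lbrakk>a \<in> carrier N; b \<in> carrier N\<rbrakk> \<Longrightarrow> a \<otimes> b \<in> carrier N"
    and mult_assoc: "\<lbrakk>a \<in> carrier N; b \<in> carrier N; c \<in> carrier N\<rbrakk>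
      \<Longrightarrow> (a \<otimes> b) \<otimes> c = a \<otimes> (b \<otimes> c)"
    and right_distrib: "\<lbrakk>a \<in> carrier N; b \<in> carrier N; n \<in> carrier N\<rbrakk>
      \<Longrightarrow> (a \<oplus> b) \<otimes> n = a \<otimes> n \<oplus> b \<otimes> n"

locale unital_loop_near_ring = loop_near_ring +
  assumes one_closed: "\<one> \<in> carrier N"
    and one_mult: "a \<in> carrier N \<Longrightarrow> \<one> \<otimes> a = a"
    and mult_one: "a \<in> carrier N \<Longrightarrow> a \<otimes> \<one> = a"

definition zero_symmetric :: "('a, 'b) ring_scheme \<Rightarrow> bool"
  where "zero_symmetric N \<longleftrightarrow> (\<forall>n\<in>carrier N. n \<otimes>\<^bsub>N\<^esub> \<zero>\<^bsub>N\<^esub> = \<zero>\<^bsub>N\<^esub>)"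

definition loop_near_field :: "('a, 'b) ring_scheme \<Rightarrow> bool"
  where "loop_near_field N \<longleftrightarrow> unital_loop_near_ring N \<and> Units N = carrier N - {\<zero>\<^bsub>N\<^esub>}"

definition subloop :: "'a set \<Rightarrow> ('a, 'b) ring_scheme \<Rightarrow> bool"
  where "subloop H N \<longleftrightarrow> H \<subseteq> carrier N \<and> H \<noteq> {} \<and>
    (\<forall>a\<in>H. \<forall>b\<in>H. a \<oplus>\<^bsub>N\<^esub> b \<in> H) \<and>
    (\<forall>a\<in>H. \<forall>b\<in>H. \<forall>x\<in>carrier N. a \<oplus>\<^bsub>N\<^esub> x = b \<longrightarrow> x \<in> H) \<and>
    (\<forall>a\<in>H. \<forall>b\<in>H. \<forall>y\<in>carrier N. y \<oplus>\<^bsub>N\<^esub> a = b \<longrightarrow> y \<in> H)"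

definition normal_subloop :: "'a set \<Rightarrow> ('a, 'b) ring_scheme \<Rightarrow> bool"
  where "normal_subloop K N \<longleftrightarrow> subloop K N \<and>
    (\<forall>a\<in>carrier N. a <+\<^bsub>N\<^esub> K = K +>\<^bsub>N\<^esub> a) \<and>
    (\<forall>a\<in>carrier N. \<forall>b\<in>carrier N. (a \<oplus>\<^bsub>N\<^esub> b) <+\<^bsub>N\<^esub> K = a <+\<^bsub>N\<^esub> (b <+\<^bsub>N\<^esub> K)) \<and>
    (\<forall>a\<in>carrier N. \<forall>b\<in>carrier N. (K +>\<^bsub>N\<^esub> a) +>\<^bsub>N\<^esub> b = K +>\<^bsub>N\<^esub> (a \<oplus>\<^bsub>N\<^esub> b))"

definition left_N_subloop :: "'a set \<Rightarrow> ('a, 'b) ring_scheme \<Rightarrow> bool"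
  where "left_N_subloop I N \<longleftrightarrow> subloop I N \<and> (\<forall>n\<in>carrier N. \<forall>i\<in>I. n \<otimes>\<^bsub>N\<^esub> i \<in> I)"

definition maximal_left_N_subloop :: "'a set \<Rightarrow> ('a, 'b) ring_scheme \<Rightarrow> bool"
  where "maximal_left_N_subloop I N \<longleftrightarrow> left_N_subloop I N \<and> I \<noteq> carrier N \<and>
    (\<forall>L. left_N_subloop L N \<and> L \<noteq> carrier N \<and> I \<subseteq> L \<longrightarrow> L = I)"

definition nr_left_ideal :: "'a set \<Rightarrow> ('a, 'b) ring_scheme \<Rightarrow> bool"
  where "nr_left_ideal K N \<longleftrightarrow> normal_subloop K N \<and>
    (\<forall>n\<in>carrier N. \<forall>a\<in>carrier N. \<forall>k\<in>K.
      (n \<otimes>\<^bsub>N\<^esub> (a \<oplus>\<^bsub>N\<^esub> k)) <+\<^bsub>N\<^esub> K = (n \<otimes>\<^bsub>N\<^esub> a) <+\<^bsub>N\<^esub> K)"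

definition nr_ideal :: "'a set \<Rightarrow> ('a, 'b) ring_scheme \<Rightarrow> bool"
  where "nr_ideal K N \<longleftrightarrow> nr_left_ideal K N \<and> (\<forall>k\<in>K. \<forall>n\<in>carrier N. k \<otimes>\<^bsub>N\<^esub> n \<in> K)"

definition N_maximal_left_ideal :: "'a set \<Rightarrow> ('a, 'b) ring_scheme \<Rightarrow> bool"
  where "N_maximal_left_ideal K N \<longleftrightarrow> nr_left_ideal K N \<and> maximal_left_N_subloop K N"

text \<open>
  The operations are the unions of the cosets \<open>(a + b) + K\<close> and \<open>ab + K\<close> over all representatives;
  \<open>nr_quotient_add\<close> and \<open>nr_quotient_mult\<close> show that for an ideal \<open>K\<close> they are \<open>(n + K) + (m + K) = (n + m) + K\<close> and
  \<open>(n + K)(m + K) = nm + K\<close>.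
\<close>

definition nr_quotient :: "('a, 'b) ring_scheme \<Rightarrow> 'a set \<Rightarrow> 'a set ring"
  where "nr_quotient N K =
    \<lparr>carrier = (\<lambda>n. n <+\<^bsub>N\<^esub> K) ` carrier N,
     mult = (\<lambda>A B. \<Union>a\<in>A. \<Union>b\<in>B. (a \<otimes>\<^bsub>N\<^esub> b) <+\<^bsub>N\<^esub> K),
     one = \<one>\<^bsub>N\<^esub> <+\<^bsub>N\<^esub> K,
     zero = \<zero>\<^bsub>N\<^esub> <+\<^bsub>N\<^esub> K,
     add = (\<lambda>A B. \<Union>a\<in>A. \<Union>b\<in>B. (a \<oplus>\<^bsub>N\<^esub> b) <+\<^bsub>N\<^esub> K)\<rparr>"

text \<open>Intersecting with the carrier gives the value \<open>N\<close> when the family is empty.\<close>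

definition J2 :: "('a, 'b) ring_scheme \<Rightarrow> 'a set"
  where "J2 N = carrier N \<inter> \<Inter> {K. N_maximal_left_ideal K N}"

definition max_subloop_radical :: "('a, 'b) ring_scheme \<Rightarrow> 'a set"
  where "max_subloop_radical N = carrier N \<inter> \<Inter> {I. maximal_left_N_subloop I N}"

text \<open>The solution \<open>y\<close> of \<open>y + q = 1\<close> is unique in a loop, so the quantifier over it is harmless.\<close>

definition quasiregular :: "('a, 'b) ring_scheme \<Rightarrow> 'a \<Rightarrow> bool"
  where "quasiregular N q \<longleftrightarrow>
    (\<exists>y\<in>carrier N. y \<oplus>\<^bsub>N\<^esub> q = \<one>\<^bsub>N\<^esub> \<and> (\<exists>z\<in>carrier N. z \<otimes>\<^bsub>N\<^esub> y = \<one>\<^bsub>N\<^esub>))"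

definition quasiregular_set :: "('a, 'b) ring_scheme \<Rightarrow> 'a set \<Rightarrow> bool"
  where "quasiregular_set N S \<longleftrightarrow> (\<forall>q\<in>S. quasiregular N q)"

definition local_loop_near_ring :: "('a, 'b) ring_scheme \<Rightarrow> bool"
  where "local_loop_near_ring N \<longleftrightarrow> (\<exists>!m. maximal_left_N_subloop m N)"

lemma a_l_coset_mem_iff: "x \<in> a <+\<^bsub>N\<^esub> K \<longleftrightarrow> (\<exists>k\<in>K. x = a \<oplus>\<^bsub>N\<^esub> k)"
  by (auto simp: a_l_coset_def l_coset_def)

lemma a_r_coset_mem_iff: "x \<in> K +>\<^bsub>N\<^esub> a \<longleftrightarrow> (\<exists>k\<in>K. x = k \<oplus>\<^bsub>N\<^esub> a)"
  by (auto simp: a_r_coset_def r_coset_def)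

lemma subloop_subset: "subloop H N \<Longrightarrow> H \<subseteq> carrier N"
  unfolding subloop_def by (elim conjE)

lemma normal_subloop_subloop: "normal_subloop K N \<Longrightarrow> subloop K N"
  unfolding normal_subloop_def by (elim conjE)

lemma normal_subloopD:
  assumes "normal_subloop K N" "a \<in> carrier N"
  shows "a <+\<^bsub>N\<^esub> K = K +>\<^bsub>N\<^esub> a"
    and "b \<in> carrier N \<Longrightarrow> (a \<oplus>\<^bsub>N\<^esub> b) <+\<^bsub>N\<^esub> K = a <+\<^bsub>N\<^esub> (b <+\<^bsub>N\<^esub> K)"
    and "b \<in> carrier N \<Longrightarrow> (K +>\<^bsub>N\<^esub> a) +>\<^bsub>N\<^esub> b = K +>\<^bsub>N\<^esub> (a \<oplus>\<^bsub>N\<^esub> b)"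
  using assms unfolding normal_subloop_def by blast+

context additive_loop
begin

lemma subloop_zero: assumes "subloop K N" shows "\<zero> \<in> K"
proof -
  obtain k where k: "k \<in> K" using assms unfolding subloop_def by blast
  then have "k \<oplus> \<zero> = k" using assms add_zero unfolding subloop_def by blast
  then show ?thesis using k assms zero_closed unfolding subloop_def by blast
qed

lemma subloop_mem_coset: assumes "subloop K N" "a \<in> carrier N" shows "a \<in> a <+ K"
  using subloop_zero[OF assms(1)] add_zero[OF assms(2)] by (metis a_l_coset_mem_iff)

lemma subloop_coset: assumes "subloop K N" "k \<in> K" shows "k <+ K = K"
proof
  show "k <+ K \<subseteq> K" using assms unfolding subloop_def by (metis a_l_coset_mem_iff subsetI)
  show "K \<subseteq> k <+ K"
  proof
    fix x assume x: "x \<in> K"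
    have "k \<in> carrier N" "x \<in> carrier N" using x assms unfolding subloop_def by blast+
    then obtain z where "z \<in> carrier N" "k \<oplus> z = x" using right_solution by blast
    moreover from this have "z \<in> K" using x assms unfolding subloop_def by blast
    ultimately show "x \<in> k <+ K" by (metis a_l_coset_mem_iff)
  qed
qed

lemma normal_coset_absorb:
  assumes "normal_subloop K N" "a \<in> carrier N" "k \<in> K"
  shows "(a \<oplus> k) <+ K = a <+ K"
proof -
  have K: "subloop K N" by (rule normal_subloop_subloop[OF assms(1)])
  have "k \<in> carrier N" using subloop_subset[OF K] assms(3) by (rule subsetD)
  then show ?thesis
    using normal_subloopD(2)[OF assms(1,2), of k] subloop_coset[OF K assms(3)] by metis
qed

lemma normal_coset_add:
  assumes K: "normal_subloop K N" and n: "n \<in> carrier N" and m: "m \<in> carrier N"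
    and a: "a \<in> n <+ K" and b: "b \<in> m <+ K"
  shows "(a \<oplus> b) <+ K = (n \<oplus> m) <+ K"
proof -
  have sub: "K \<subseteq> carrier N" by (rule subloop_subset[OF normal_subloop_subloop[OF K]])
  obtain k where k: "k \<in> K" "b = m \<oplus> k" using b by (auto simp: a_l_coset_mem_iff)
  have ac: "a \<in> carrier N" using a n sub add_closed by (auto simp: a_l_coset_mem_iff)
  have bc: "b \<in> carrier N" using k m sub add_closed by auto
  have "(a \<oplus> b) <+ K = a <+ (b <+ K)" by (rule normal_subloopD(2)[OF K ac bc])
  also have "\<dots> = a <+ (m <+ K)" using normal_coset_absorb[OF K m k(1)] k by simp
  also have "\<dots> = (a \<oplus> m) <+ K" by (rule normal_subloopD(2)[OF K ac m, symmetric])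
  finally have 1: "(a \<oplus> b) <+ K = (a \<oplus> m) <+ K" .
  have "a \<in> K +> n" using a normal_subloopD(1)[OF K n] by simp
  then have "a \<oplus> m \<in> (K +> n) +> m" by (metis a_r_coset_mem_iff)
  also have "(K +> n) +> m = (n \<oplus> m) <+ K"
    using normal_subloopD(3)[OF K n m] normal_subloopD(1)[OF K add_closed[OF n m]] by simp
  finally obtain k' where k': "k' \<in> K" "a \<oplus> m = (n \<oplus> m) \<oplus> k'"
    by (metis a_l_coset_mem_iff)
  then show ?thesis using 1 normal_coset_absorb[OF K add_closed[OF n m] k'(1)] by metis
qed

lemma nr_quotient_add:
  assumes K: "normal_subloop K N" and n: "n \<in> carrier N" and m: "m \<in> carrier N"
  shows "(n <+ K) \<oplus>\<^bsub>nr_quotient N K\<^esub> (m <+ K) = (n \<oplus> m) <+ K"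
proof -
  have "n \<in> n <+ K" "m \<in> m <+ K"
    using subloop_mem_coset[OF normal_subloop_subloop[OF K]] n m by simp_all
  then have "(\<Union>a\<in>n <+ K. \<Union>b\<in>m <+ K. (a \<oplus> b) <+ K) = (n \<oplus> m) <+ K"
    using normal_coset_add[OF K n m] by blast
  then show ?thesis by (simp only: nr_quotient_def ring.simps)
qed

end

lemma (in loop_near_ring) nr_quotient_mult:
  assumes K: "nr_ideal K N" and n: "n \<in> carrier N" and m: "m \<in> carrier N"
  shows "(n <+ K) \<otimes>\<^bsub>nr_quotient N K\<^esub> (m <+ K) = (n \<otimes> m) <+ K"
proof -
  have nK: "normal_subloop K N" using K unfolding nr_ideal_def nr_left_ideal_def by blast
  have sub: "K \<subseteq> carrier N" by (rule subloop_subset[OF normal_subloop_subloop[OF nK]])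
  have mem: "n \<in> n <+ K" "m \<in> m <+ K"
    using subloop_mem_coset[OF normal_subloop_subloop[OF nK]] n m by simp_all
  have "(a \<otimes> b) <+ K = (n \<otimes> m) <+ K" if ab: "a \<in> n <+ K" "b \<in> m <+ K" for a b
  proof -
    obtain k where k: "k \<in> K" "a = n \<oplus> k" using ab(1) by (auto simp: a_l_coset_mem_iff)
    obtain l where l: "l \<in> K" "b = m \<oplus> l" using ab(2) by (auto simp: a_l_coset_mem_iff)
    have ac: "a \<in> carrier N" using k n sub add_closed by auto
    have "(a \<otimes> b) <+ K = (a \<otimes> m) <+ K"
      using K ac m l unfolding nr_ideal_def nr_left_ideal_def by blast
    also have "a \<otimes> m = n \<otimes> m \<oplus> k \<otimes> m" using k n m sub right_distrib by auto
    also have "(n \<otimes> m \<oplus> k \<otimes> m) <+ K = (n \<otimes> m) <+ K"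
      using normal_coset_absorb[OF nK mult_closed[OF n m]] K k(1) m
      unfolding nr_ideal_def by metis
    finally show ?thesis .
  qed
  then have "(\<Union>a\<in>n <+ K. \<Union>b\<in>m <+ K. (a \<otimes> b) <+ K) = (n \<otimes> m) <+ K" using mem by blast
  then show ?thesis by (simp only: nr_quotient_def monoid.simps)
qed

end

theory Submission
  imports Defs
begin

text \<open>
  All six conditions amount to one: for an \<open>N\<close>-maximal left ideal \<open>K\<close>, every element outside \<open>K\<close>
  has a left inverse.  If \<open>x \<notin> K\<close>, then \<open>N x + K = N\<close> by maximality, so
  \<open>n x + k = 1\<close> with \<open>k \<in> K\<close>; quasiregularity of \<open>k\<close> or condition (f) then makes \<open>n x\<close>, hence \<open>x\<close>,
  left invertible.
  Conversely left inverses outside \<open>K\<close> are two-sided: if \<open>b a = 1\<close> and \<open>b \<in> K\<close>, then the solution \<open>y\<close>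
  of \<open>y + a b = 1\<close> lies outside \<open>K\<close>, so it is left invertible, while multiplying by \<open>a\<close> on the right
  gives \<open>y a = 0\<close>, hence \<open>a = 0\<close>.  Therefore \<open>K\<close> is the set of nonunits, and everything else follows.
\<close>

section \<open>Cosets of normal subloops and the quotient loop\<close>

context additive_loop
begin

lemma add_left_cancel:
  assumes "a \<in> carrier N" "x \<in> carrier N" "y \<in> carrier N" "a \<oplus> x = a \<oplus> y"
  shows "x = y"
  using right_solution[OF assms(1) add_closed[OF assms(1,2)]] assms by metis

lemma add_right_cancel:
  assumes "a \<in> carrier N" "x \<in> carrier N" "y \<in> carrier N" "x \<oplus> a = y \<oplus> a"
  shows "x = y"
  using left_solution[OF assms(1) add_closed[OF assms(2,1)]] assms by metis

lemma right_solutionE: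
  assumes "a \<in> carrier N" "b \<in> carrier N"
  obtains x where "x \<in> carrier N" "a \<oplus> x = b"
  using right_solution[OF assms] by blast

lemma left_solutionE:
  assumes "a \<in> carrier N" "b \<in> carrier N"
  obtains y where "y \<in> carrier N" "y \<oplus> a = b"
  using left_solution[OF assms] by blast

lemma normal_subloop_mem: "\<lbrakk>normal_subloop K N; k \<in> K\<rbrakk> \<Longrightarrow> k \<in> carrier N"
  using subloop_subset[OF normal_subloop_subloop] by blast

lemma normal_coset_eq_iff:
  assumes K: "normal_subloop K N" and a: "a \<in> carrier N" and b: "b \<in> carrier N"
  shows "a <+ K = b <+ K \<longleftrightarrow> b \<in> a <+ K"
proof
  assume "a <+ K = b <+ K"
  then show "b \<in> a <+ K" using subloop_mem_coset[OF normal_subloop_subloop[OF K] b] by simp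
next
  assume "b \<in> a <+ K"
  then obtain k where "k \<in> K" "b = a \<oplus> k" by (auto simp: a_l_coset_mem_iff)
  then show "a <+ K = b <+ K" using normal_coset_absorb[OF K a] by simp
qed

lemma subloop_zero_coset:
  assumes "subloop K N" shows "\<zero> <+ K = K"
  using subloop_coset[OF assms subloop_zero[OF assms]] .

lemma normal_coset_eq_subloop_iff:
  assumes K: "normal_subloop K N" and a: "a \<in> carrier N"
  shows "a <+ K = K \<longleftrightarrow> a \<in> K"
  using normal_coset_eq_iff[OF K zero_closed a] subloop_zero_coset[OF normal_subloop_subloop[OF K]]
  by metis

lemma normal_coset_add_cong:
  assumes K: "normal_subloop K N" and "a \<in> carrier N" "a' \<in> carrier N" "b \<in> carrier N" "b' \<in> carrier N"
    and "a <+ K = a' <+ K" "b <+ K = b' <+ K"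
  shows "(a \<oplus> b) <+ K = (a' \<oplus> b') <+ K"
  using assms by (metis normal_coset_add[OF K] normal_coset_eq_iff[OF K])

text \<open>Normality turns the coset of \<open>a \<oplus> x\<close> into the translate by
  \<open>a\<close> of the coset of \<open>x\<close>, so cancelling \<open>a\<close> in the loop
  cancels it modulo \<open>K\<close>. This provides uniqueness of solutions in the quotient.\<close>

lemma normal_coset_left_cancel:
  assumes K: "normal_subloop K N" and a: "a \<in> carrier N" and x: "x \<in> carrier N" and y: "y \<in> carrier N"
    and eq: "(a \<oplus> x) <+ K = (a \<oplus> y) <+ K"
  shows "x <+ K = y <+ K"
proof -
  have "a \<oplus> y \<in> a <+ (x <+ K)"
    using eq normal_coset_eq_iff[OF K add_closed[OF a x] add_closed[OF a y]]
      normal_subloopD(2)[OF K a x] by simp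
  then obtain k where k: "k \<in> K" "a \<oplus> y = a \<oplus> (x \<oplus> k)" by (auto simp: a_l_coset_mem_iff)
  have kc: "k \<in> carrier N" using K k(1) by (rule normal_subloop_mem)
  have "y = x \<oplus> k" using add_left_cancel[OF a y add_closed[OF x kc] k(2)] .
  then show ?thesis using normal_coset_absorb[OF K x k(1)] by simp
qed

text \<open>Translation by \<open>a\<close> on the right is available for right cosets, so left
  cosets are exchanged for right ones before cancelling \<open>a\<close>, and back
  afterwards.\<close>

lemma normal_coset_right_cancel:
  assumes K: "normal_subloop K N" and a: "a \<in> carrier N" and x: "x \<in> carrier N" and y: "y \<in> carrier N"
    and eq: "(x \<oplus> a) <+ K = (y \<oplus> a) <+ K"
  shows "x <+ K = y <+ K"
proof -
  have "y \<oplus> a \<in> (K +> x) +> a"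
    using eq normal_coset_eq_iff[OF K add_closed[OF x a] add_closed[OF y a]]
      normal_subloopD(3)[OF K x a] normal_subloopD(1)[OF K add_closed[OF x a]] by simp
  then obtain k where k: "k \<in> K" "y \<oplus> a = (k \<oplus> x) \<oplus> a" by (auto simp: a_r_coset_mem_iff)
  have kc: "k \<in> carrier N" using K k(1) by (rule normal_subloop_mem)
  have "y = k \<oplus> x" using add_right_cancel[OF a y add_closed[OF kc x] k(2)] .
  then have "y \<in> x <+ K" using k(1) normal_subloopD(1)[OF K x] by (metis a_r_coset_mem_iff)
  then show ?thesis using normal_coset_eq_iff[OF K x y] by simp
qed

text \<open>Cosets of solutions for representatives solve the equations in the quotient;
  cancellation modulo \<open>K\<close> excludes any others.\<close>

lemma nr_quotient_additive_loop:
  assumes K: "normal_subloop K N"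
  shows "additive_loop (nr_quotient N K)"
proof -
  let ?Q = "nr_quotient N K"
  have car: "carrier ?Q = (\<lambda>n. n <+ K) ` carrier N" and zero: "\<zero>\<^bsub>?Q\<^esub> = \<zero> <+ K"
    by (simp_all add: nr_quotient_def)
  note add = nr_quotient_add[OF K]
  show ?thesis
  proof
    fix A B assume AB: "A \<in> carrier ?Q" "B \<in> carrier ?Q"
    then obtain a b where a: "a \<in> carrier N" "A = a <+ K" and b: "b \<in> carrier N" "B = b <+ K"
      unfolding car by auto
    show "A \<oplus>\<^bsub>?Q\<^esub> B \<in> carrier ?Q" using a b add add_closed car by auto
    obtain x where x: "x \<in> carrier N" "a \<oplus> x = b" using right_solutionE a b by metis
    show "\<exists>!X. X \<in> carrier ?Q \<and> A \<oplus>\<^bsub>?Q\<^esub> X = B"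
    proof (rule ex1I[of _ "x <+ K"])
      show "x <+ K \<in> carrier ?Q \<and> A \<oplus>\<^bsub>?Q\<^esub> (x <+ K) = B" using a b x add car by auto
      fix X assume X: "X \<in> carrier ?Q \<and> A \<oplus>\<^bsub>?Q\<^esub> X = B"
      then obtain z where z: "z \<in> carrier N" "X = z <+ K" unfolding car by auto
      have "(a \<oplus> z) <+ K = (a \<oplus> x) <+ K" using X a b z x add by auto
      then show "X = x <+ K" using normal_coset_left_cancel[OF K a(1) z(1) x(1)] z by simp
    qed
    obtain y where y: "y \<in> carrier N" "y \<oplus> a = b" using left_solutionE a b by metis
    show "\<exists>!Y. Y \<in> carrier ?Q \<and> Y \<oplus>\<^bsub>?Q\<^esub> A = B"
    proof (rule ex1I[of _ "y <+ K"])
      show "y <+ K \<in> carrier ?Q \<and> (y <+ K) \<oplus>\<^bsub>?Q\<^esub> A = B" using a b y add car by auto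
      fix Y assume Y: "Y \<in> carrier ?Q \<and> Y \<oplus>\<^bsub>?Q\<^esub> A = B"
      then obtain z where z: "z \<in> carrier N" "Y = z <+ K" unfolding car by auto
      have "(z \<oplus> a) <+ K = (y \<oplus> a) <+ K" using Y a b z y add by auto
      then show "Y = y <+ K" using normal_coset_right_cancel[OF K a(1) z(1) y(1)] z by simp
    qed
  next
    show "\<zero>\<^bsub>?Q\<^esub> \<in> carrier ?Q" using zero car zero_closed by auto
  next
    fix A assume "A \<in> carrier ?Q"
    then show "\<zero>\<^bsub>?Q\<^esub> \<oplus>\<^bsub>?Q\<^esub> A = A" "A \<oplus>\<^bsub>?Q\<^esub> \<zero>\<^bsub>?Q\<^esub> = A"
      unfolding car zero using add zero_closed zero_add add_zero by auto
  qed
qed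

end

section \<open>Left ideals, their intersections, and their sums with left N-subloops\<close>

context loop_near_ring
begin

lemma nr_left_ideal_normal: "nr_left_ideal K N \<Longrightarrow> normal_subloop K N"
  unfolding nr_left_ideal_def by blast

lemma nr_left_ideal_mult_cong:
  assumes K: "nr_left_ideal K N" and n: "n \<in> carrier N" and a: "a \<in> carrier N" and b: "b \<in> carrier N"
    and eq: "a <+ K = b <+ K"
  shows "(n \<otimes> a) <+ K = (n \<otimes> b) <+ K"
proof -
  have "b \<in> a <+ K" using eq normal_coset_eq_iff[OF nr_left_ideal_normal[OF K] a b] by simp
  then obtain k where "k \<in> K" "b = a \<oplus> k" by (auto simp: a_l_coset_mem_iff)
  then show ?thesis using K n a unfolding nr_left_ideal_def by metis
qed

text \<open>Defining left ideals by congruences makes their intersections left ideals, because congruences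
  can simply be intersected.\<close>

lemma nr_left_ideal_of_congruence:
  assumes equiv: "\<And>x. r x x" "\<And>x y. r x y \<Longrightarrow> r y x" "\<And>x y z. \<lbrakk>r x y; r y z\<rbrakk> \<Longrightarrow> r x z"
    and add: "\<And>a b x y. \<lbrakk>a \<in> carrier N; b \<in> carrier N; x \<in> carrier N; y \<in> carrier N; r a b; r x y\<rbrakk>
      \<Longrightarrow> r (a \<oplus> x) (b \<oplus> y)"
    and lcancel: "\<And>a x y. \<lbrakk>a \<in> carrier N; x \<in> carrier N; y \<in> carrier N; r (a \<oplus> x) (a \<oplus> y)\<rbrakk> \<Longrightarrow> r x y"
    and rcancel: "\<And>a x y. \<lbrakk>a \<in> carrier N; x \<in> carrier N; y \<in> carrier N; r (x \<oplus> a) (y \<oplus> a)\<rbrakk> \<Longrightarrow> r x y"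
    and mult: "\<And>n x y. \<lbrakk>n \<in> carrier N; x \<in> carrier N; y \<in> carrier N; r x y\<rbrakk> \<Longrightarrow> r (n \<otimes> x) (n \<otimes> y)"
  shows "nr_left_ideal {x \<in> carrier N. r x \<zero>} N" (is "nr_left_ideal ?K N")
proof -
  \<comment> \<open>The left coset of \<open>a\<close>, and below also the right coset, is the
    congruence class of \<open>a\<close>. Normality thus becomes a matter of comparing
    classes.\<close>
  have l: "a <+ ?K = {b \<in> carrier N. r b a}" if a: "a \<in> carrier N" for a
  proof (intro Set.set_eqI iffI)
    fix b assume "b \<in> a <+ ?K"
    then obtain k where k: "k \<in> carrier N" "r k \<zero>" "b = a \<oplus> k" by (auto simp: a_l_coset_mem_iff)
    have "r (a \<oplus> k) (a \<oplus> \<zero>)" using add[OF a a k(1) zero_closed equiv(1) k(2)] .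
    then show "b \<in> {b \<in> carrier N. r b a}" using k a add_zero add_closed by auto
  next
    fix b assume b: "b \<in> {b \<in> carrier N. r b a}"
    then obtain k where k: "k \<in> carrier N" "a \<oplus> k = b" using right_solutionE a by blast
    then have "r k \<zero>" using lcancel[OF a k(1) zero_closed] b add_zero[OF a] by simp
    then show "b \<in> a <+ ?K" using k by (auto simp: a_l_coset_mem_iff)
  qed
  have rr: "?K +> a = {b \<in> carrier N. r b a}" if a: "a \<in> carrier N" for a
  proof (intro Set.set_eqI iffI)
    fix b assume "b \<in> ?K +> a"
    then obtain k where k: "k \<in> carrier N" "r k \<zero>" "b = k \<oplus> a" by (auto simp: a_r_coset_mem_iff)
    have "r (k \<oplus> a) (\<zero> \<oplus> a)" using add[OF k(1) zero_closed a a k(2) equiv(1)] .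
    then show "b \<in> {b \<in> carrier N. r b a}" using k a zero_add add_closed by auto
  next
    fix b assume b: "b \<in> {b \<in> carrier N. r b a}"
    then obtain k where k: "k \<in> carrier N" "k \<oplus> a = b" using left_solutionE a by blast
    then have "r k \<zero>" using rcancel[OF a k(1) zero_closed] b zero_add[OF a] by simp
    then show "b \<in> ?K +> a" using k by (auto simp: a_r_coset_mem_iff)
  qed
  have sub: "subloop ?K N" unfolding subloop_def
  proof (intro conjI ballI impI)
    show "?K \<noteq> {}" using zero_closed equiv(1) by blast
    fix a b assume ab: "a \<in> ?K" "b \<in> ?K"
    show "a \<oplus> b \<in> ?K"
      using ab add[of a \<zero> b \<zero>] zero_closed add_closed zero_add[OF zero_closed] by auto
    fix x assume x: "x \<in> carrier N"
    \<comment> \<open>As \<open>a\<close> is congruent to zero, adding it does not change the class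
      of \<open>x\<close>; so \<open>x\<close> is congruent to \<open>b\<close>, hence to
      zero.\<close>
    { assume "a \<oplus> x = b"
      then have "r (a \<oplus> x) \<zero>" using ab by simp
      moreover have "r (a \<oplus> x) x" using add[of a \<zero> x x] ab x zero_closed zero_add equiv(1) by auto
      ultimately show "x \<in> ?K" using x equiv(2,3) by blast }
    { assume "x \<oplus> a = b"
      then have "r (x \<oplus> a) \<zero>" using ab by simp
      moreover have "r (x \<oplus> a) x" using add[of x x a \<zero>] ab x zero_closed add_zero equiv(1) by auto
      ultimately show "x \<in> ?K" using x equiv(2,3) by blast }
  qed auto
  have cong: "{b \<in> carrier N. r b x} = {b \<in> carrier N. r b y}" if "r x y" for x y
    using that equiv(2,3) by blast
  show ?thesis unfolding nr_left_ideal_def normal_subloop_def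
  proof (intro conjI ballI sub)
    fix a assume a: "a \<in> carrier N"
    show "a <+ ?K = ?K +> a" using l[OF a] rr[OF a] by simp
    fix b assume b: "b \<in> carrier N"
    \<comment> \<open>Any \<open>c\<close> congruent to \<open>a \<oplus> b\<close> can be written
      \<open>a \<oplus> d\<close>, and cancelling \<open>a\<close> in the congruence places
      \<open>d\<close> in the class of \<open>b\<close>. The converse is compatibility with
      addition.\<close>
    show "(a \<oplus> b) <+ ?K = a <+ (b <+ ?K)"
    proof (intro Set.set_eqI iffI)
      fix c assume "c \<in> (a \<oplus> b) <+ ?K"
      then have c: "c \<in> carrier N" "r c (a \<oplus> b)" using l[OF add_closed[OF a b]] by auto
      obtain d where d: "d \<in> carrier N" "a \<oplus> d = c" using right_solutionE[OF a c(1)] .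
      then have "r d b" using lcancel[OF a d(1) b] c by simp
      then show "c \<in> a <+ (b <+ ?K)" using d l[OF b] by (auto simp: a_l_coset_mem_iff[of _ _ a])
    next
      fix c assume "c \<in> a <+ (b <+ ?K)"
      then obtain d where d: "d \<in> carrier N" "r d b" "c = a \<oplus> d"
        unfolding l[OF b] by (auto simp: a_l_coset_mem_iff)
      then show "c \<in> (a \<oplus> b) <+ ?K"
        unfolding l[OF add_closed[OF a b]] using add_closed[OF a] add[OF a a d(1) b equiv(1) d(2)] by simp
    qed
    show "(?K +> a) +> b = ?K +> (a \<oplus> b)"
    proof (intro Set.set_eqI iffI)
      fix c assume "c \<in> ?K +> (a \<oplus> b)"
      then have c: "c \<in> carrier N" "r c (a \<oplus> b)" using rr[OF add_closed[OF a b]] by auto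
      obtain d where d: "d \<in> carrier N" "d \<oplus> b = c" using left_solutionE[OF b c(1)] .
      then have "r d a" using rcancel[OF b d(1) a] c by simp
      then show "c \<in> (?K +> a) +> b" using d rr[OF a] by (auto simp: a_r_coset_mem_iff[of _ _ _ b])
    next
      fix c assume "c \<in> (?K +> a) +> b"
      then obtain d where d: "d \<in> carrier N" "r d a" "c = d \<oplus> b"
        unfolding rr[OF a] by (auto simp: a_r_coset_mem_iff)
      then show "c \<in> ?K +> (a \<oplus> b)"
        unfolding rr[OF add_closed[OF a b]] using add_closed[OF _ b] add[OF d(1) a b b d(2) equiv(1)] by simp
    qed
  next
    fix n a k assume n: "n \<in> carrier N" and a: "a \<in> carrier N" and k: "k \<in> ?K"
    have kc: "k \<in> carrier N" using k by simp
    have "r (a \<oplus> k) a" using add[OF a a kc zero_closed equiv(1)] k add_zero[OF a] by simp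
    then have "r (n \<otimes> (a \<oplus> k)) (n \<otimes> a)" using mult[OF n add_closed[OF a kc] a] by simp
    then show "(n \<otimes> (a \<oplus> k)) <+ ?K = (n \<otimes> a) <+ ?K"
      unfolding l[OF mult_closed[OF n a]] l[OF mult_closed[OF n add_closed[OF a kc]]] by (rule cong)
  qed
qed

text \<open>Lying in the same coset of every member of \<open>F\<close> is a congruence whose zero
  class is the intersection. Intersecting with the carrier covers an empty \<open>F\<close>; the
  form matches the definition of \<open>J2\<close>.\<close>

lemma nr_left_ideal_Inter:
  assumes F: "\<And>K. K \<in> F \<Longrightarrow> nr_left_ideal K N"
  shows "nr_left_ideal (carrier N \<inter> \<Inter> F) N"
proof -
  let ?r = "\<lambda>x y. \<forall>K\<in>F. x <+ K = y <+ K"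
  have normal: "normal_subloop K N" if "K \<in> F" for K by (rule nr_left_ideal_normal[OF F[OF that]])
  have "nr_left_ideal {x \<in> carrier N. ?r x \<zero>} N"
  proof (rule nr_left_ideal_of_congruence[where r = ?r])
    fix a b x y assume "a \<in> carrier N" "b \<in> carrier N" "x \<in> carrier N" "y \<in> carrier N" "?r a b" "?r x y"
    then show "?r (a \<oplus> x) (b \<oplus> y)" using normal_coset_add_cong[OF normal] by blast
  next
    fix a x y assume "a \<in> carrier N" "x \<in> carrier N" "y \<in> carrier N" "?r (a \<oplus> x) (a \<oplus> y)"
    then show "?r x y" using normal_coset_left_cancel[OF normal] by blast
  next
    fix a x y assume "a \<in> carrier N" "x \<in> carrier N" "y \<in> carrier N" "?r (x \<oplus> a) (y \<oplus> a)"
    then show "?r x y" using normal_coset_right_cancel[OF normal] by blast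
  next
    fix n x y assume "n \<in> carrier N" "x \<in> carrier N" "y \<in> carrier N" "?r x y"
    then show "?r (n \<otimes> x) (n \<otimes> y)" using nr_left_ideal_mult_cong[OF F] by blast
  qed auto
  moreover have "{x \<in> carrier N. ?r x \<zero>} = carrier N \<inter> \<Inter> F"
  proof -
    have "x <+ K = \<zero> <+ K \<longleftrightarrow> x \<in> K" if "K \<in> F" "x \<in> carrier N" for x K
      using normal_coset_eq_subloop_iff[OF normal[OF that(1)] that(2)]
        subloop_zero_coset[OF normal_subloop_subloop[OF normal[OF that(1)]]] by simp
    then have "{x \<in> carrier N. ?r x \<zero>} = {x \<in> carrier N. \<forall>K\<in>F. x \<in> K}"
      by (intro Collect_cong) blast
    then show ?thesis by auto
  qed
  ultimately show ?thesis by simp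
qed

lemma zero_mult: assumes "n \<in> carrier N" shows "\<zero> \<otimes> n = \<zero>"
proof -
  have c: "\<zero> \<otimes> n \<in> carrier N" using mult_closed[OF zero_closed assms] .
  have "\<zero> \<otimes> n \<oplus> \<zero> \<otimes> n = \<zero> \<otimes> n \<oplus> \<zero>"
    using right_distrib[OF zero_closed zero_closed assms] zero_add[OF zero_closed] add_zero[OF c] by simp
  then show ?thesis by (rule add_left_cancel[OF c c zero_closed])
qed

text \<open>By right distributivity, multiplication by \<open>a\<close> on the right is an additive
  homomorphism, so its image is a subloop: an equation between multiples of \<open>a\<close> is
  solved by solving it for the coefficients.\<close>

lemma left_N_subloop_principal:
  assumes a: "a \<in> carrier N"
  shows "left_N_subloop ((\<lambda>n. n \<otimes> a) ` carrier N) N"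
  unfolding left_N_subloop_def subloop_def
proof (intro conjI ballI impI)
  show "(\<lambda>n. n \<otimes> a) ` carrier N \<subseteq> carrier N" using mult_closed a by blast
  show "(\<lambda>n. n \<otimes> a) ` carrier N \<noteq> {}" using zero_closed by blast
next
  fix u v assume "u \<in> (\<lambda>n. n \<otimes> a) ` carrier N" "v \<in> (\<lambda>n. n \<otimes> a) ` carrier N"
  then obtain m n where m: "m \<in> carrier N" "u = m \<otimes> a" and n: "n \<in> carrier N" "v = n \<otimes> a" by auto
  show "u \<oplus> v \<in> (\<lambda>n. n \<otimes> a) ` carrier N"
    using m n right_distrib[OF m(1) n(1) a] add_closed by (metis imageI)
  fix x assume x: "x \<in> carrier N"
  { assume ux: "u \<oplus> x = v"
    obtain z where z: "z \<in> carrier N" "m \<oplus> z = n" using right_solutionE m n by metis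
    have "u \<oplus> x = u \<oplus> z \<otimes> a" using ux m n z right_distrib[OF m(1) z(1) a] by simp
    then have "x = z \<otimes> a" using add_left_cancel x mult_closed m z a by metis
    then show "x \<in> (\<lambda>n. n \<otimes> a) ` carrier N" using z by blast }
  { assume ux: "x \<oplus> u = v"
    obtain z where z: "z \<in> carrier N" "z \<oplus> m = n" using left_solutionE m n by metis
    have "x \<oplus> u = z \<otimes> a \<oplus> u" using ux m n z right_distrib[OF z(1) m(1) a] by simp
    then have "x = z \<otimes> a" using add_right_cancel x mult_closed m z a by metis
    then show "x \<in> (\<lambda>n. n \<otimes> a) ` carrier N" using z by blast }
next
  fix n u assume "n \<in> carrier N" "u \<in> (\<lambda>n. n \<otimes> a) ` carrier N"
  then show "n \<otimes> u \<in> (\<lambda>n. n \<otimes> a) ` carrier N" using mult_assoc a mult_closed by (auto simp: image_iff) metis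
qed

text \<open>The set is S + K, described as the union of the cosets of \<open>K\<close> that meet
  \<open>S\<close>. In this form all closure properties are those of \<open>S\<close> read modulo
  \<open>K\<close>, and no reassociation of sums is required.\<close>

lemma left_N_subloop_sum:
  assumes S: "left_N_subloop S N" and K: "nr_left_ideal K N"
  shows "left_N_subloop {y \<in> carrier N. \<exists>s\<in>S. y <+ K = s <+ K} N" (is "left_N_subloop ?L N")
proof -
  note nK = nr_left_ideal_normal[OF K]
  have subS: "subloop S N" and NS: "\<And>n s. \<lbrakk>n \<in> carrier N; s \<in> S\<rbrakk> \<Longrightarrow> n \<otimes> s \<in> S"
    using S unfolding left_N_subloop_def by blast+
  have Sc: "s \<in> carrier N" if "s \<in> S" for s using subloop_subset[OF subS] that by blast
  have Sadd: "s \<oplus> t \<in> S" if "s \<in> S" "t \<in> S" for s t using subS that unfolding subloop_def by blast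
  show ?thesis unfolding left_N_subloop_def subloop_def
  proof (intro conjI ballI impI)
    show "?L \<noteq> {}" using subloop_zero[OF subS] zero_closed by blast
    fix a b assume "a \<in> ?L" "b \<in> ?L"
    then obtain s t where a: "a \<in> carrier N" "s \<in> S" "a <+ K = s <+ K"
      and b: "b \<in> carrier N" "t \<in> S" "b <+ K = t <+ K" by blast
    note s = Sc[OF a(2)] and t = Sc[OF b(2)]
    show "a \<oplus> b \<in> ?L"
      using normal_coset_add_cong[OF nK a(1) s b(1) t a(3) b(3)] Sadd[OF a(2) b(2)] add_closed[OF a(1) b(1)]
      by blast
    fix x assume x: "x \<in> carrier N"
    { assume ax: "a \<oplus> x = b"
      obtain z where z: "z \<in> carrier N" "s \<oplus> z = t" using right_solutionE[OF s t] .
      then have zS: "z \<in> S" using subS a b unfolding subloop_def by blast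
      have "(a \<oplus> x) <+ K = (a \<oplus> z) <+ K"
        using normal_coset_add_cong[OF nK a(1) s z(1) z(1) a(3) refl] ax z b by simp
      then have "x <+ K = z <+ K" by (rule normal_coset_left_cancel[OF nK a(1) x z(1)])
      then show "x \<in> ?L" using x zS by blast }
    { assume ax: "x \<oplus> a = b"
      obtain z where z: "z \<in> carrier N" "z \<oplus> s = t" using left_solutionE[OF s t] .
      then have zS: "z \<in> S" using subS a b unfolding subloop_def by blast
      have "(x \<oplus> a) <+ K = (z \<oplus> a) <+ K"
        using normal_coset_add_cong[OF nK z(1) z(1) a(1) s refl a(3)] ax z b by simp
      then have "x <+ K = z <+ K" by (rule normal_coset_right_cancel[OF nK a(1) x z(1)])
      then show "x \<in> ?L" using x zS by blast }
  next
    fix n y assume n: "n \<in> carrier N" and "y \<in> ?L"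
    then obtain s where y: "y \<in> carrier N" "s \<in> S" "y <+ K = s <+ K" by blast
    have "(n \<otimes> y) <+ K = (n \<otimes> s) <+ K"
      using nr_left_ideal_mult_cong[OF K n y(1) Sc[OF y(2)] y(3)] .
    then show "n \<otimes> y \<in> ?L" using NS[OF n y(2)] mult_closed[OF n y(1)] by blast
  qed auto
qed

end

section \<open>Maximal left N-subloops\<close>

context unital_loop_near_ring
begin

lemma left_N_subloop_proper_iff:
  assumes "left_N_subloop I N"
  shows "I \<noteq> carrier N \<longleftrightarrow> \<one> \<notin> I"
proof -
  have "I \<subseteq> carrier N" "\<And>n. \<lbrakk>n \<in> carrier N; \<one> \<in> I\<rbrakk> \<Longrightarrow> n \<otimes> \<one> \<in> I"
    using assms unfolding left_N_subloop_def subloop_def by blast+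
  then show ?thesis using mult_one one_closed by auto
qed

lemma left_N_subloop_proper_not_left_invertible:
  assumes "left_N_subloop I N" "I \<noteq> carrier N" "x \<in> I" "z \<in> carrier N"
  shows "z \<otimes> x \<noteq> \<one>"
  using assms left_N_subloop_proper_iff unfolding left_N_subloop_def by metis

text \<open>Zorn's lemma. Properness is expressed as \<open>\<one> \<notin> L\<close>, a condition
  that passes to unions of chains.\<close>

lemma ex_maximal_left_N_subloop:
  assumes I: "left_N_subloop I N" and proper: "I \<noteq> carrier N"
  obtains M where "maximal_left_N_subloop M N" "I \<subseteq> M"
proof -
  define A where "A = {L. left_N_subloop L N \<and> \<one> \<notin> L \<and> I \<subseteq> L}"
  have "\<exists>U\<in>A. \<forall>L\<in>C. L \<subseteq> U" if C: "subset.chain A C" for C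
  proof (cases "C = {}")
    case True
    \<comment> \<open>The empty chain is bounded by \<open>I\<close> itself.\<close>
    then show ?thesis using I proper left_N_subloop_proper_iff[OF I] unfolding A_def by blast
  next
    case False
    have CA: "\<And>L. L \<in> C \<Longrightarrow> L \<in> A" and tot: "\<And>L M. \<lbrakk>L \<in> C; M \<in> C\<rbrakk> \<Longrightarrow> L \<subseteq> M \<or> M \<subseteq> L"
      using C unfolding subset_chain_def by blast+
    have sub: "subloop L N" "\<And>n i. \<lbrakk>n \<in> carrier N; i \<in> L\<rbrakk> \<Longrightarrow> n \<otimes> i \<in> L" "\<one> \<notin> L" "I \<subseteq> L"
      if "L \<in> C" for L
      using CA[OF that] unfolding A_def left_N_subloop_def by blast+
    \<comment> \<open>Any two elements of the union already lie in a common member of the chain,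
      where the closure properties can be applied.\<close>
    have pair: "\<exists>L\<in>C. a \<in> L \<and> b \<in> L" if "a \<in> \<Union> C" "b \<in> \<Union> C" for a b
      using that tot by blast
    have "subloop (\<Union> C) N" unfolding subloop_def
    proof (intro conjI ballI impI)
      show "\<Union> C \<subseteq> carrier N" using sub(1) subloop_subset by blast
      show "\<Union> C \<noteq> {}" using False sub(1) unfolding subloop_def by blast
      fix a b assume "a \<in> \<Union> C" "b \<in> \<Union> C"
      then obtain L where L: "L \<in> C" "a \<in> L" "b \<in> L" using pair by blast
      show "a \<oplus> b \<in> \<Union> C" using sub(1)[OF L(1)] L unfolding subloop_def by blast
      fix x assume x: "x \<in> carrier N"
      show "x \<in> \<Union> C" if "a \<oplus> x = b" using sub(1)[OF L(1)] L x that unfolding subloop_def by blast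
      show "x \<in> \<Union> C" if "x \<oplus> a = b" using sub(1)[OF L(1)] L x that unfolding subloop_def by blast
    qed
    then have "\<Union> C \<in> A" unfolding A_def left_N_subloop_def using sub(2,3,4) False by blast
    then show ?thesis by blast
  qed
  then obtain M where M: "M \<in> A" "\<And>L. \<lbrakk>L \<in> A; M \<subseteq> L\<rbrakk> \<Longrightarrow> L = M"
    using subset_Zorn[of A] by metis
  have "maximal_left_N_subloop M N"
    unfolding maximal_left_N_subloop_def
    using M left_N_subloop_proper_iff unfolding A_def by blast
  then show ?thesis using that M(1) unfolding A_def by blast
qed

section \<open>The quotient loop near-ring\<close>

lemma nr_quotient_unital_loop_near_ring:
  assumes K: "nr_ideal K N"
  shows "unital_loop_near_ring (nr_quotient N K)"
proof -
  let ?Q = "nr_quotient N K"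
  have nK: "normal_subloop K N" using K unfolding nr_ideal_def nr_left_ideal_def by blast
  interpret Q: additive_loop ?Q by (rule nr_quotient_additive_loop[OF nK])
  have car: "carrier ?Q = (\<lambda>n. n <+ K) ` carrier N" and one: "\<one>\<^bsub>?Q\<^esub> = \<one> <+ K"
    by (simp_all add: nr_quotient_def)
  note add = nr_quotient_add[OF nK] and mult = nr_quotient_mult[OF K]
  show ?thesis
  proof
    fix A assume A: "A \<in> carrier ?Q"
    then obtain a where a: "a \<in> carrier N" "A = a <+ K" unfolding car by auto
    show "\<one>\<^bsub>?Q\<^esub> \<otimes>\<^bsub>?Q\<^esub> A = A" "A \<otimes>\<^bsub>?Q\<^esub> \<one>\<^bsub>?Q\<^esub> = A"
      using a one mult one_closed one_mult mult_one by auto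
    fix B assume B: "B \<in> carrier ?Q"
    then obtain b where b: "b \<in> carrier N" "B = b <+ K" unfolding car by auto
    show "A \<otimes>\<^bsub>?Q\<^esub> B \<in> carrier ?Q" using a b mult mult_closed car by auto
    fix C assume C: "C \<in> carrier ?Q"
    then obtain c where c: "c \<in> carrier N" "C = c <+ K" unfolding car by auto
    show "(A \<otimes>\<^bsub>?Q\<^esub> B) \<otimes>\<^bsub>?Q\<^esub> C = A \<otimes>\<^bsub>?Q\<^esub> (B \<otimes>\<^bsub>?Q\<^esub> C)"
      using a b c mult mult_closed mult_assoc by simp
    show "(A \<oplus>\<^bsub>?Q\<^esub> B) \<otimes>\<^bsub>?Q\<^esub> C = A \<otimes>\<^bsub>?Q\<^esub> C \<oplus>\<^bsub>?Q\<^esub> B \<otimes>\<^bsub>?Q\<^esub> C"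
      using a b c mult add mult_closed add_closed right_distrib by simp
  next
    show "\<one>\<^bsub>?Q\<^esub> \<in> carrier ?Q" using one car one_closed by auto
  qed
qed

section \<open>Quasiregularity, left inverses and units\<close>

lemma quasiregular_left_invertible:
  assumes q: "quasiregular N q" "q \<in> carrier N" and y: "y \<in> carrier N" "y \<oplus> q = \<one>"
  shows "\<exists>z\<in>carrier N. z \<otimes> y = \<one>"
  \<comment> \<open>The definition provides a left inverse for some solution; right cancellation
    identifies that solution with the given \<open>y\<close>.\<close>
  using assms add_right_cancel unfolding quasiregular_def by metis

lemma left_factor_invertible:
  assumes "\<exists>z\<in>carrier N. z \<otimes> (n \<otimes> x) = \<one>" "n \<in> carrier N" "x \<in> carrier N"
  shows "\<exists>z\<in>carrier N. z \<otimes> x = \<one>"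
  using assms mult_assoc mult_closed by metis

text \<open>Here \<open>y\<close> stands in for 1 - ab, and the claim is the loop version of (1 -
  ab)a = a - a(ba) = 0.\<close>

lemma mult_annihilates:
  assumes a: "a \<in> carrier N" and b: "b \<in> carrier N" and y: "y \<in> carrier N"
    and ba: "b \<otimes> a = \<one>" and yab: "y \<oplus> a \<otimes> b = \<one>"
  shows "y \<otimes> a = \<zero>"
proof -
  have "(y \<oplus> a \<otimes> b) \<otimes> a = y \<otimes> a \<oplus> a"
    using right_distrib[OF y mult_closed[OF a b] a] mult_assoc[OF a b a] ba mult_one[OF a] by simp
  then have "y \<otimes> a \<oplus> a = \<zero> \<oplus> a" using yab one_mult[OF a] zero_add[OF a] by simp
  then show ?thesis using add_right_cancel[OF a] mult_closed[OF y a] zero_closed by blast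
qed

lemma maximal_left_ideal_complement:
  assumes K: "N_maximal_left_ideal K N" and x: "x \<in> carrier N" "x \<notin> K"
  obtains n k where "n \<in> carrier N" "k \<in> K" "n \<otimes> x \<oplus> k = \<one>"
proof -
  have lK: "nr_left_ideal K N" and max: "maximal_left_N_subloop K N"
    using K unfolding N_maximal_left_ideal_def by blast+
  note nK = nr_left_ideal_normal[OF lK]
  \<comment> \<open>\<open>L\<close> is Nx + K. It contains \<open>K\<close> as the coset of 0x and
    \<open>x\<close> as 1x, so maximality of \<open>K\<close> makes it everything.\<close>
  define L where "L = {y \<in> carrier N. \<exists>s\<in>(\<lambda>n. n \<otimes> x) ` carrier N. y <+ K = s <+ K}"
  have L: "left_N_subloop L N"
    unfolding L_def by (rule left_N_subloop_sum[OF left_N_subloop_principal[OF x(1)] lK])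
  have "K \<subseteq> L"
  proof
    fix k assume k: "k \<in> K"
    have "k <+ K = (\<zero> \<otimes> x) <+ K"
      using subloop_coset[OF normal_subloop_subloop[OF nK] k] zero_mult[OF x(1)]
        subloop_zero_coset[OF normal_subloop_subloop[OF nK]] by simp
    then show "k \<in> L" unfolding L_def using normal_subloop_mem[OF nK k] zero_closed by blast
  qed
  moreover have "x \<in> L" unfolding L_def using x(1) one_closed one_mult[OF x(1)] by force
  ultimately have "L = carrier N" using L max x(2) unfolding maximal_left_N_subloop_def by blast
  then obtain n where n: "n \<in> carrier N" "\<one> <+ K = (n \<otimes> x) <+ K" unfolding L_def using one_closed by auto
  then have "\<one> \<in> (n \<otimes> x) <+ K"
    using subloop_mem_coset[OF normal_subloop_subloop[OF nK] one_closed] by simp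
  then show ?thesis using that n(1) by (auto simp: a_l_coset_mem_iff)
qed

text \<open>A unit in \<open>K\<close> would put \<open>\<one>\<close> into \<open>K\<close>.
  Conversely, a left inverse \<open>b\<close> of some \<open>a\<close> outside \<open>K\<close> is
  shown to lie outside \<open>K\<close> as well, so it has a left inverse of its own, which can only
  be \<open>a\<close>.\<close>

lemma Units_eq_complement:
  assumes zs: "zero_symmetric N" and K: "left_N_subloop K N" "K \<noteq> carrier N"
    and inv: "\<And>x. \<lbrakk>x \<in> carrier N; x \<notin> K\<rbrakk> \<Longrightarrow> \<exists>z\<in>carrier N. z \<otimes> x = \<one>"
  shows "Units N = carrier N - K"
proof
  show "Units N \<subseteq> carrier N - K"
    using left_N_subloop_proper_not_left_invertible[OF K] unfolding Units_def by blast
  show "carrier N - K \<subseteq> Units N"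
  proof
    fix a assume "a \<in> carrier N - K"
    then have a: "a \<in> carrier N" "a \<notin> K" by auto
    obtain b where b: "b \<in> carrier N" "b \<otimes> a = \<one>" using inv[OF a] by blast
    have zero: "\<zero> \<in> K" using K subloop_zero unfolding left_N_subloop_def by blast
    have "b \<notin> K"
    proof
      assume bK: "b \<in> K"
      have ab: "a \<otimes> b \<in> K" using K bK a unfolding left_N_subloop_def by blast
      obtain y where y: "y \<in> carrier N" "y \<oplus> a \<otimes> b = \<one>"
        using left_solutionE[OF mult_closed[OF a(1) b(1)] one_closed] .
      \<comment> \<open>Otherwise \<open>\<one>\<close>, the sum of \<open>y\<close> and
        \<open>a \<otimes> b\<close>, would be in \<open>K\<close>.\<close>
      have "y \<notin> K"
        using ab y(2) K left_N_subloop_proper_iff[OF K(1)] unfolding left_N_subloop_def subloop_def by metis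
      then obtain z where z: "z \<in> carrier N" "z \<otimes> y = \<one>" using inv y(1) by blast
      \<comment> \<open>Zero symmetry enters here: \<open>y \<otimes> a\<close> vanishes, and so
        does its multiple by \<open>z\<close> on the left.\<close>
      have "a = z \<otimes> (y \<otimes> a)" using mult_assoc[OF z(1) y(1) a(1)] z(2) one_mult[OF a(1)] by simp
      also have "\<dots> = \<zero>"
        using mult_annihilates[OF a(1) b(1) y(1) b(2) y(2)] zs z(1) unfolding zero_symmetric_def by simp
      finally show False using zero a(2) by simp
    qed
    then obtain c where c: "c \<in> carrier N" "c \<otimes> b = \<one>" using inv b(1) by blast
    have "c = c \<otimes> (b \<otimes> a)" using b mult_one[OF c(1)] by simp
    also have "\<dots> = a" using mult_assoc[OF c(1) b(1) a(1)] c(2) one_mult[OF a(1)] by simp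
    finally show "a \<in> Units N" using a b c unfolding Units_def by blast
  qed
qed

text \<open>If \<open>k \<otimes> n\<close> were a unit, \<open>k\<close> would have a right inverse
  \<open>r\<close>. Since \<open>K\<close> absorbs left multiplication and is proper,
  \<open>r\<close> is not in \<open>K\<close>, so it is a unit; its inverse equals \<open>k\<close>,
  making \<open>k\<close> a unit.\<close>

lemma nr_ideal_nonunits:
  assumes K: "nr_left_ideal K N" "left_N_subloop K N" "K \<noteq> carrier N" and U: "Units N = carrier N - K"
  shows "nr_ideal K N"
  unfolding nr_ideal_def
proof (intro conjI ballI K(1))
  fix k n assume k: "k \<in> K" and n: "n \<in> carrier N"
  have kc: "k \<in> carrier N" by (rule normal_subloop_mem[OF nr_left_ideal_normal[OF K(1)] k])
  show "k \<otimes> n \<in> K"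
  proof (rule ccontr)
    assume "k \<otimes> n \<notin> K"
    then have "k \<otimes> n \<in> Units N" using U mult_closed[OF kc n] by simp
    then obtain v where v: "v \<in> carrier N" "(k \<otimes> n) \<otimes> v = \<one>" unfolding Units_def by blast
    define r where "r = n \<otimes> v"
    have r: "r \<in> carrier N" "k \<otimes> r = \<one>"
      using mult_closed[OF n v(1)] mult_assoc[OF kc n v(1)] v(2) unfolding r_def by simp_all
    have "r \<notin> K" using left_N_subloop_proper_not_left_invertible[OF K(2,3) _ kc] r(2) by blast
    then obtain s where s: "s \<in> carrier N" "s \<otimes> r = \<one>" "r \<otimes> s = \<one>" using U r unfolding Units_def by blast
    have "k = k \<otimes> (r \<otimes> s)" using s mult_one[OF kc] by simp
    also have "\<dots> = s" using mult_assoc[OF kc r(1) s(1)] r(2) one_mult[OF s(1)] by simp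
    finally have "k \<in> Units N" using s r kc unfolding Units_def by blast
    then show False using U k by blast
  qed
qed

section \<open>Loop near-field quotients and uniqueness of the maximal left N-subloop\<close>

lemma loop_near_field_quotient:
  assumes K: "nr_ideal K N" and one: "\<one> \<notin> K" and U: "Units N = carrier N - K"
  shows "loop_near_field (nr_quotient N K)"
  unfolding loop_near_field_def
proof
  let ?Q = "nr_quotient N K"
  have nK: "normal_subloop K N" using K unfolding nr_ideal_def nr_left_ideal_def by blast
  show Q: "unital_loop_near_ring ?Q" by (rule nr_quotient_unital_loop_near_ring[OF K])
  interpret Q: unital_loop_near_ring ?Q by (rule Q)
  have car: "carrier ?Q = (\<lambda>n. n <+ K) ` carrier N" and one_Q: "\<one>\<^bsub>?Q\<^esub> = \<one> <+ K"
    and zero_Q: "\<zero>\<^bsub>?Q\<^esub> = K"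
    using subloop_zero_coset[OF normal_subloop_subloop[OF nK]] by (simp_all add: nr_quotient_def)
  note mult = nr_quotient_mult[OF K]
  show "Units ?Q = carrier ?Q - {\<zero>\<^bsub>?Q\<^esub>}"
  proof
    show "Units ?Q \<subseteq> carrier ?Q - {\<zero>\<^bsub>?Q\<^esub>}"
    proof
      fix A assume A: "A \<in> Units ?Q"
      then obtain B where B: "A \<in> carrier ?Q" "B \<in> carrier ?Q" "A \<otimes>\<^bsub>?Q\<^esub> B = \<one>\<^bsub>?Q\<^esub>"
        unfolding Units_def by blast
      have "A \<noteq> \<zero>\<^bsub>?Q\<^esub>"
      proof
        assume "A = \<zero>\<^bsub>?Q\<^esub>"
        \<comment> \<open>Zero times anything is zero in the quotient, so an invertible zero coset
          would coincide with the coset of \<open>\<one>\<close>.\<close>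
        then have "\<one> <+ K = K" using B Q.zero_mult one_Q zero_Q by simp
        then show False using normal_coset_eq_subloop_iff[OF nK one_closed] one by simp
      qed
      then show "A \<in> carrier ?Q - {\<zero>\<^bsub>?Q\<^esub>}" using B by simp
    qed
    show "carrier ?Q - {\<zero>\<^bsub>?Q\<^esub>} \<subseteq> Units ?Q"
    proof
      fix A assume A: "A \<in> carrier ?Q - {\<zero>\<^bsub>?Q\<^esub>}"
      then obtain a where a: "a \<in> carrier N" "A = a <+ K" unfolding car by auto
      then have "a \<notin> K" using A normal_coset_eq_subloop_iff[OF nK a(1)] zero_Q by simp
      then obtain b where b: "b \<in> carrier N" "b \<otimes> a = \<one>" "a \<otimes> b = \<one>"
        using U a unfolding Units_def by blast
      have "(b <+ K) \<otimes>\<^bsub>?Q\<^esub> A = \<one>\<^bsub>?Q\<^esub>" "A \<otimes>\<^bsub>?Q\<^esub> (b <+ K) = \<one>\<^bsub>?Q\<^esub>"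
        using mult a b one_Q by simp_all
      then show "A \<in> Units ?Q" using A b(1) car unfolding Units_def by blast
    qed
  qed
qed

text \<open>Serves condition (c) while \<open>K\<close> is known only as a left ideal, so that the
  product of cosets is just a union over representatives. One of these, \<open>a\<close>, becomes
  the witness; the other may be replaced by \<open>x\<close>, because left multiplication respects
  cosets.\<close>

lemma loop_near_field_quotient_complement:
  assumes K: "nr_left_ideal K N" and field: "loop_near_field (nr_quotient N K)"
    and x: "x \<in> carrier N" "x \<notin> K"
  obtains n k where "n \<in> carrier N" "k \<in> K" "n \<otimes> x \<oplus> k = \<one>"
proof -
  let ?Q = "nr_quotient N K"
  note nK = nr_left_ideal_normal[OF K]
  have "x <+ K \<in> carrier ?Q - {\<zero>\<^bsub>?Q\<^esub>}"
    using x normal_coset_eq_subloop_iff[OF nK x(1)] subloop_zero_coset[OF normal_subloop_subloop[OF nK]]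
    by (auto simp: nr_quotient_def)
  then obtain B where B: "B \<in> carrier ?Q" "B \<otimes>\<^bsub>?Q\<^esub> (x <+ K) = \<one>\<^bsub>?Q\<^esub>"
    using field unfolding loop_near_field_def Units_def by blast
  obtain n where n: "n \<in> carrier N" "B = n <+ K" using B(1) by (auto simp: nr_quotient_def)
  have "\<one> \<in> B \<otimes>\<^bsub>?Q\<^esub> (x <+ K)"
    using B(2) subloop_mem_coset[OF normal_subloop_subloop[OF nK] one_closed] by (simp add: nr_quotient_def)
  then obtain a b where a: "a \<in> n <+ K" and b: "b \<in> x <+ K" and one: "\<one> \<in> (a \<otimes> b) <+ K"
    unfolding n(2) nr_quotient_def by auto
  have carrier: "a \<in> carrier N" "b \<in> carrier N"
    using a b n x normal_subloop_mem[OF nK] add_closed by (auto simp: a_l_coset_mem_iff)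
  have "x <+ K = b <+ K" using normal_coset_eq_iff[OF nK x(1) carrier(2)] b by simp
  then have "(a \<otimes> x) <+ K = (a \<otimes> b) <+ K" by (rule nr_left_ideal_mult_cong[OF K carrier(1) x(1) carrier(2)])
  then have "\<one> \<in> (a \<otimes> x) <+ K" using one by simp
  then show ?thesis using that carrier(1) by (auto simp: a_l_coset_mem_iff)
qed

text \<open>A proper left N-subloop has no left invertible element, so it lies inside
  \<open>K\<close>; maximality then forces equality.\<close>

lemma unique_maximal_of_left_inverses:
  assumes K: "maximal_left_N_subloop K N"
    and inv: "\<And>x. \<lbrakk>x \<in> carrier N; x \<notin> K\<rbrakk> \<Longrightarrow> \<exists>z\<in>carrier N. z \<otimes> x = \<one>"
  shows "maximal_left_N_subloop I N \<longleftrightarrow> I = K"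
proof
  assume I: "maximal_left_N_subloop I N"
  have Il: "left_N_subloop I N" "I \<noteq> carrier N" using I unfolding maximal_left_N_subloop_def by blast+
  then have "I \<subseteq> carrier N" unfolding left_N_subloop_def subloop_def by blast
  then have "I \<subseteq> K" using inv left_N_subloop_proper_not_left_invertible[OF Il] by blast
  then show "I = K" using I K unfolding maximal_left_N_subloop_def by blast
qed (use K in simp)

end

section \<open>Equivalence of the six conditions\<close>

theorem theorem3p3:
  fixes N :: "('a, 'b) ring_scheme" (structure)
  assumes "unital_loop_near_ring N"
    and "zero_symmetric N"
    and "J2 N \<noteq> carrier N"
  shows "let
      a = local_loop_near_ring N;
      b = ((\<exists>!K. N_maximal_left_ideal K N) \<and>
           (\<forall>K. N_maximal_left_ideal K N \<longrightarrow> quasiregular_set N K));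
      c = (quasiregular_set N (J2 N) \<and> loop_near_field (nr_quotient N (J2 N)));
      d = nr_ideal (carrier N - Units N) N;
      e = subloop (carrier N - Units N) N;
      f = (\<forall>m\<in>carrier N. \<forall>n\<in>carrier N. m \<oplus> n \<in> Units N \<longrightarrow> m \<in> Units N \<or> n \<in> Units N)
    in (a \<longleftrightarrow> b) \<and> (b \<longleftrightarrow> c) \<and> (c \<longleftrightarrow> d) \<and> (d \<longleftrightarrow> e) \<and> (e \<longleftrightarrow> f) \<and>
       (a \<or> b \<or> c \<or> d \<or> e \<or> f \<longrightarrow>
         (\<exists>m. (\<forall>I. maximal_left_N_subloop I N \<longleftrightarrow> I = m) \<and>
              m = max_subloop_radical N \<and>
              max_subloop_radical N = J2 N \<and>
              J2 N = carrier N - Units N))"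
proof -
  interpret unital_loop_near_ring N by fact
  note zs = assms(2)
  define U where "U = carrier N - Units N"
  define a where "a = local_loop_near_ring N"
  define b where "b = ((\<exists>!K. N_maximal_left_ideal K N) \<and>
    (\<forall>K. N_maximal_left_ideal K N \<longrightarrow> quasiregular_set N K))"
  define c where "c = (quasiregular_set N (J2 N) \<and> loop_near_field (nr_quotient N (J2 N)))"
  define d where "d = nr_ideal U N"
  define e where "e = subloop U N"
  define f where "f = (\<forall>m\<in>carrier N. \<forall>n\<in>carrier N. m \<oplus> n \<in> Units N \<longrightarrow> m \<in> Units N \<or> n \<in> Units N)"
  define g where "g = (\<exists>m. (\<forall>I. maximal_left_N_subloop I N \<longleftrightarrow> I = m) \<and>
    m = max_subloop_radical N \<and> max_subloop_radical N = J2 N \<and> J2 N = U)"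
  \<comment> \<open>Without N-maximal left ideals the intersection defining \<open>J2 N\<close>
    would be the whole carrier.\<close>
  obtain K where K: "N_maximal_left_ideal K N" using assms(3) unfolding J2_def by blast
  have lK: "nr_left_ideal K N" and max: "maximal_left_N_subloop K N"
    using K unfolding N_maximal_left_ideal_def by blast+
  have NK: "left_N_subloop K N" "K \<noteq> carrier N" using max unfolding maximal_left_N_subloop_def by blast+
  have one: "\<one> \<notin> K" using left_N_subloop_proper_iff NK by blast
  have sK: "subloop K N" using NK unfolding left_N_subloop_def by blast
  have Kc: "K \<subseteq> carrier N" by (rule subloop_subset[OF sK])
  have lJ: "nr_left_ideal (J2 N) N"
    unfolding J2_def by (rule nr_left_ideal_Inter) (simp add: N_maximal_left_ideal_def)
  have JK: "J2 N \<subseteq> K" using K unfolding J2_def by blast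
  \<comment> \<open>\<open>h\<close> is the hub: it yields all six conditions and the equalities
    \<open>g\<close>, while (a), (b), (c) and (f) each lead back to it; (d) and (e) return through
    (f).\<close>
  define h where "h = (\<forall>x\<in>carrier N. x \<notin> K \<longrightarrow> (\<exists>z\<in>carrier N. z \<otimes> x = \<one>))"
  have h_all: "a \<and> b \<and> c \<and> d \<and> e \<and> f \<and> g" if h
  proof -
    have inv: "\<And>x. \<lbrakk>x \<in> carrier N; x \<notin> K\<rbrakk> \<Longrightarrow> \<exists>z\<in>carrier N. z \<otimes> x = \<one>"
      using that unfolding h_def by blast
    have UK: "Units N = carrier N - K" by (rule Units_eq_complement[OF zs NK inv])
    have U: "U = K" using UK Kc unfolding U_def by blast
    have uniq: "maximal_left_N_subloop I N \<longleftrightarrow> I = K" for I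
      by (rule unique_maximal_of_left_inverses[OF max inv])
    have uniq_ideal: "N_maximal_left_ideal I N \<longleftrightarrow> I = K" for I
      using K uniq unfolding N_maximal_left_ideal_def by blast
    have J: "J2 N = K" using Kc uniq_ideal unfolding J2_def by auto
    have R: "max_subloop_radical N = K" using Kc uniq unfolding max_subloop_radical_def by auto
    have ideal: "nr_ideal K N" by (rule nr_ideal_nonunits[OF lK NK UK])
    have qr: "quasiregular_set N K" unfolding quasiregular_set_def quasiregular_def
    proof
      fix q assume q: "q \<in> K"
      obtain y where y: "y \<in> carrier N" "y \<oplus> q = \<one>" using left_solutionE[of q \<one>] one_closed q Kc by blast
      \<comment> \<open>If \<open>y\<close> were in \<open>K\<close>, so would be the sum
        \<open>y \<oplus> q\<close>, which is \<open>\<one>\<close>.\<close>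
      then have "y \<notin> K" using q one sK unfolding subloop_def by metis
      then show "\<exists>y\<in>carrier N. y \<oplus> q = \<one> \<and> (\<exists>z\<in>carrier N. z \<otimes> y = \<one>)" using inv y by blast
    qed
    have f: f unfolding f_def UK using sK add_closed unfolding subloop_def by blast
    show ?thesis
      unfolding a_def local_loop_near_ring_def b_def c_def d_def e_def g_def J R U uniq uniq_ideal
      using loop_near_field_quotient[OF ideal one UK] f qr ideal sK by auto
  qed
  have a_h: h if a
    unfolding h_def
  proof (intro ballI impI)
    fix x assume x: "x \<in> carrier N" "x \<notin> K"
    \<comment> \<open>If Nx were proper, it would lie in a maximal left N-subloop, which by (a) is
      \<open>K\<close>; but Nx contains \<open>x\<close>.\<close>
    have "(\<lambda>n. n \<otimes> x) ` carrier N = carrier N"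
    proof (rule ccontr)
      assume "(\<lambda>n. n \<otimes> x) ` carrier N \<noteq> carrier N"
      then obtain M where M: "maximal_left_N_subloop M N" "(\<lambda>n. n \<otimes> x) ` carrier N \<subseteq> M"
        using ex_maximal_left_N_subloop[OF left_N_subloop_principal[OF x(1)]] by metis
      have "M = K" using that M max unfolding a_def local_loop_near_ring_def by blast
      then show False using M x one_closed one_mult[OF x(1)] by force
    qed
    then show "\<exists>z\<in>carrier N. z \<otimes> x = \<one>" using one_closed by (metis image_iff)
  qed
  have b_h: h if b
    unfolding h_def
  proof (intro ballI impI)
    fix x assume x: "x \<in> carrier N" "x \<notin> K"
    obtain n k where n: "n \<in> carrier N" and k: "k \<in> K" and nk: "n \<otimes> x \<oplus> k = \<one>"
      using maximal_left_ideal_complement[OF K x] .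
    have "quasiregular N k" using that K k unfolding b_def quasiregular_set_def by blast
    then show "\<exists>z\<in>carrier N. z \<otimes> x = \<one>"
      using left_factor_invertible[OF quasiregular_left_invertible[OF _ _ mult_closed nk]] n k Kc x by blast
  qed
  have c_h: h if c
    unfolding h_def
  proof (intro ballI impI)
    fix x assume x: "x \<in> carrier N" "x \<notin> K"
    have field: "loop_near_field (nr_quotient N (J2 N))" and xJ: "x \<notin> J2 N"
      using that x JK unfolding c_def by blast+
    \<comment> \<open>The complement is taken with respect to \<open>J2 N\<close> instead of
      \<open>K\<close>, since (c) makes only its elements quasiregular.\<close>
    obtain n k where n: "n \<in> carrier N" and k: "k \<in> J2 N" and nk: "n \<otimes> x \<oplus> k = \<one>"
      using loop_near_field_quotient_complement[OF lJ field x(1) xJ] .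
    have "quasiregular N k" using that k unfolding c_def quasiregular_set_def by blast
    then show "\<exists>z\<in>carrier N. z \<otimes> x = \<one>"
      using left_factor_invertible[OF quasiregular_left_invertible[OF _ _ mult_closed nk]] n k JK Kc x by blast
  qed
  have d_e: e if d
    using that unfolding d_def e_def nr_ideal_def nr_left_ideal_def normal_subloop_def by blast
  have e_f: f if e
    using that unfolding e_def f_def subloop_def U_def by blast
  have f_h: h if f
    unfolding h_def
  proof (intro ballI impI)
    fix x assume x: "x \<in> carrier N" "x \<notin> K"
    obtain n k where n: "n \<in> carrier N" and k: "k \<in> K" and nk: "n \<otimes> x \<oplus> k = \<one>"
      using maximal_left_ideal_complement[OF K x] .
    \<comment> \<open>In the decomposition of \<open>\<one>\<close> the summand from
      \<open>K\<close> is no unit, so (f) makes the other summand one.\<close>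
    have "k \<notin> Units N"
      using left_N_subloop_proper_not_left_invertible[OF NK k] unfolding Units_def by blast
    moreover have "\<one> \<in> Units N" using one_closed one_mult[OF one_closed] unfolding Units_def by blast
    ultimately have "n \<otimes> x \<in> Units N"
      using that nk mult_closed[OF n x(1)] k Kc unfolding f_def by (metis subsetD)
    then show "\<exists>z\<in>carrier N. z \<otimes> x = \<one>"
      using left_factor_invertible[OF _ n x(1)] unfolding Units_def by blast
  qed
  have "(a \<longleftrightarrow> b) \<and> (b \<longleftrightarrow> c) \<and> (c \<longleftrightarrow> d) \<and> (d \<longleftrightarrow> e) \<and> (e \<longleftrightarrow> f) \<and> (a \<or> b \<or> c \<or> d \<or> e \<or> f \<longrightarrow> g)"
    using h_all a_h b_h c_h d_e e_f f_h by blast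
  then show ?thesis
    unfolding Let_def a_def b_def c_def d_def e_def f_def g_def U_def .
qed

end
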